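(* Suppose $g$ is differentiable, strongly convex with constant $\eta_g>0$, with $\nabla_\theta g$ Lipschitz continuous with constant $G_g$; $F(\cdot;\theta)$ is monotone on $X$ for each $\theta\in\Theta$; $\|F(x_1;\theta)-F(x_2;\theta)\|\le L_{F,x}\|x_1-x_2\|$ for all $x_1,x_2\in X$, $\theta\in\Theta$; $\|F(x;\theta_1)-F(x;\theta_2)\|\le L_{F,\theta}\|\theta_1-\theta_2\|$ for all $\theta_1,\theta_2\in\Theta$, $x\in X$; and $X$ is compact. Let $\{\gamma_{f,k}\}$, $\{\epsilon_k\}$ be positive sequences with $\epsilon_k\to0$ and $\gamma_{g,k}=\gamma_g$ constant, such that: (a) $0<\gamma_{f,k}\le\frac{\epsilon_k}{(L_{F,x}+\epsilon_k)^2}\le\frac{\epsilon_0}{L_{F,x}^2}$ for all $k$; (b) $\gamma_{f,k}\epsilon_k<1$ for all $k$ and $\sum_{k=1}^\infty\gamma_{f,k}\epsilon_k=\infty$; (c) $\lim_{k\to\infty}\frac{|\epsilon_{k-1}-\epsilon_k|}{\gamma_{f,k}\epsilon_k^2}=0$; (d) $0<\gamma_g<2/G_g$, $\lim_{k\to\infty}\frac{q_g^k}{\epsilon_k}=0$ and $\lim_{k\to\infty}\frac{q_g^{k-1}}{\gamma_{f,k}\epsilon_k^2}=0$, where $q_g=\sqrt{1-\gamma_g\eta_g(2-\gamma_gG_g)}$. Let $\{(x_k,\theta_k)\}$ be generated by the regularized projection scheme. Then, as $k\to\infty$, $\{\theta_k\}$ converges to $\theta^*$, the minimizer of $g$ over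 $\Theta$, and $\{x_k\}$ converges to $x^*$, the least-norm element of the solution set $X^*$ of $\mathrm{VI}(X,F(\cdot;\theta^* ))$.
   Context: $X\subseteq\mathbb{R}^n$ and $\Theta\subseteq\mathbb{R}^m$ are nonempty closed convex sets, $F:X\times\Theta\to\mathbb{R}^n$, $g:\mathbb{R}^m\to\mathbb{R}$. $\mathrm{VI}(X,F(\cdot;\theta))$ asks for $x\in X$ with $(y-x)^TF(x;\theta)\ge0$ for all $y\in X$. $F(\cdot;\theta)$ is monotone on $X$ if $(F(x;\theta)-F(y;\theta))^T(x-y)\ge0$ for all $x,y\in X$. A differentiable function $h$ is strongly convex with constant $\eta$ if $(\nabla h(u)-\nabla h(v))^T(u-v)\ge\eta\|u-v\|^2$ for all $u,v$. $\Pi_Y$ denotes Euclidean projection onto $Y$. The regularized projection scheme, given $x_0\in X$, $\theta_0\in\Theta$ and sequences $\{\gamma_{f,k}\},\{\gamma_{g,k}\},\{\epsilon_k\}$, is: for all $k\ge0$, $x_{k+1}=\Pi_X(x_k-\gamma_{f,k}(F(x_k;\theta_k)+\epsilon_kx_k))$ and $\theta_{k+1}=\Pi_\Theta(\theta_k-\gamma_{g,k}\nabla_\theta g(\theta_k))$. *)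

theory Defs
  imports "HOL-Analysis.Analysis"
begin

definition VI_solutions :: "'a::real_inner set \<Rightarrow> ('a \<Rightarrow> 'a) \<Rightarrow> 'a set" where
  "VI_solutions X G = {x \<in> X. \<forall>y\<in>X. (y - x) \<bullet> G x \<ge> 0}"

text \<open>Monotonicity in the sense of operators; \<open>monotone_on\<close> is the order-theoretic notion.\<close>

definition monotone_map_on :: "'a::real_inner set \<Rightarrow> ('a \<Rightarrow> 'a) \<Rightarrow> bool" where
  "monotone_map_on X G \<longleftrightarrow> (\<forall>x\<in>X. \<forall>y\<in>X. (G x - G y) \<bullet> (x - y) \<ge> 0)"

text \<open>Meaningful at points of differentiability only; see \<open>GDERIV_gradient\<close>.\<close>

definition gradient :: "('a::euclidean_space \<Rightarrow> real) \<Rightarrow> 'a \<Rightarrow> 'a" where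
  "gradient h u = (THE D. GDERIV h u :> D)"

lemma GDERIV_unique_gradient:
  fixes h :: "'a::euclidean_space \<Rightarrow> real"
  assumes "GDERIV h u :> D"
  shows "gradient h u = D"
  unfolding gradient_def
proof (rule the_equality)
  fix D' assume "GDERIV h u :> D'"
  with assms have "(\<lambda>v. v \<bullet> D') = (\<lambda>v. v \<bullet> D)"
    unfolding gderiv_def by (blast intro: has_derivative_unique)
  then show "D' = D"
    by (metis inner_commute vector_eq_rdot)
qed (fact assms)

lemma GDERIV_gradient:
  fixes h :: "'a::euclidean_space \<Rightarrow> real"
  assumes "h differentiable (at u)"
  shows "GDERIV h u :> gradient h u"
proof -
  obtain h' where h': "(h has_derivative h') (at u)"
    using assms unfolding differentiable_def by blast
  then have lin: "linear h'"
    by (rule has_derivative_linear)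
  have "h' v = v \<bullet> adjoint h' 1" for v
    using adjoint_works[OF lin, of v 1] by simp
  with h' have "GDERIV h u :> adjoint h' 1"
    unfolding gderiv_def by (metis (no_types, lifting) ext)
  then show ?thesis
    using GDERIV_unique_gradient by metis
qed

definition strongly_convex :: "real \<Rightarrow> ('a::euclidean_space \<Rightarrow> real) \<Rightarrow> bool" where
  "strongly_convex \<eta> h \<longleftrightarrow>
     (\<forall>u. h differentiable (at u)) \<and>
     (\<forall>u v. (gradient h u - gradient h v) \<bullet> (u - v) \<ge> \<eta> * (norm (u - v))\<^sup>2)"

text \<open>
  \<open>closest_point Y\<close> is the Euclidean projection onto \<open>Y\<close>, which is well defined when \<open>Y\<close>
  is nonempty, closed and convex.
\<close>

definition regularized_projection_scheme ::
  "(real^'n) set \<Rightarrow> (real^'m) set \<Rightarrow> (real^'n \<Rightarrow> real^'m \<Rightarrow> real^'n) \<Rightarrow> (real^'m \<Rightarrow> real) \<Rightarrow>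
   (nat \<Rightarrow> real) \<Rightarrow> (nat \<Rightarrow> real) \<Rightarrow> (nat \<Rightarrow> real) \<Rightarrow>
   (nat \<Rightarrow> real^'n) \<Rightarrow> (nat \<Rightarrow> real^'m) \<Rightarrow> bool" where
  "regularized_projection_scheme X \<Theta> F g \<gamma>\<^sub>f \<gamma>\<^sub>g \<epsilon> x \<theta> \<longleftrightarrow>
     x 0 \<in> X \<and> \<theta> 0 \<in> \<Theta> \<and>
     (\<forall>k. x (Suc k) = closest_point X (x k - \<gamma>\<^sub>f k *\<^sub>R (F (x k) (\<theta> k) + \<epsilon> k *\<^sub>R x k)) \<and>
          \<theta> (Suc k) = closest_point \<Theta> (\<theta> k - \<gamma>\<^sub>g k *\<^sub>R gradient g (\<theta> k)))"

end

theory Submission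
  imports Defs
begin

text \<open>
  By the Baillon--Haddad inequality the projected gradient step contracts with factor \<open>q\<^sub>g\<close>,
  so \<open>\<theta>\<close> converges geometrically. For \<open>x\<close>, compare with the Tikhonov trajectory \<open>y k\<close>, the solution
  of \<open>VI(X, F(\<cdot>;\<theta>\<^sub>s) + \<epsilon> k I)\<close>. It converges to the least-norm solution and moves by at most
  \<open>M \<bar>\<epsilon> (k - 1) - \<epsilon> k\<bar> / \<epsilon> k\<close> per step, where \<open>M\<close> bounds \<open>X\<close>. As each step in \<open>x\<close> contracts towards
  \<open>y k\<close> with factor \<open>sqrt (1 - \<gamma>\<^sub>f k * \<epsilon> k) \<le> 1 - \<gamma>\<^sub>f k * \<epsilon> k / 2\<close> up to an error \<open>O(\<gamma>\<^sub>f k * q\<^sub>g ^ k)\<close>, the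
  distances \<open>norm (x (k + 1) - y k)\<close> obey a recursion \<open>a (k + 1) \<le> (1 - t k) * a k + t k * c k\<close> with
  \<open>c\<close> tending to 0 and \<open>\<Sum> t = \<infinity>\<close>, which forces them to 0.
\<close>

section \<open>Null sequences from recursions, and limits from subsequences\<close>

text \<open>Once \<open>c k\<close> stays below \<open>e / 2\<close>, the excess of \<open>a\<close>
  over \<open>e / 2\<close> shrinks by \<open>1 - t k\<close>, which is at most
  \<open>exp (- t k)\<close>. The product of these factors tends to 0 because the sum of
  \<open>t\<close> diverges.\<close>

lemma averaged_recursion_tendsto_0:
  fixes a c t :: "nat \<Rightarrow> real"
  assumes nonneg: "\<And>k. 0 \<le> a k"
    and t: "\<And>k. 0 \<le> t k" "\<And>k. t k \<le> 1"
    and rec: "\<And>k. a (Suc k) \<le> (1 - t k) * a k + t k * c k"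
    and c: "c \<longlonglongrightarrow> 0"
    and div: "filterlim (\<lambda>N. \<Sum>k<N. t k) at_top sequentially"
  shows "a \<longlonglongrightarrow> 0"
proof (rule LIMSEQ_I)
  fix e :: real assume e: "e > 0"
  obtain N where N: "\<And>k. k \<ge> N \<Longrightarrow> c k \<le> e / 2"
    using order_tendstoD(2)[OF c, of "e / 2"] e
    by (auto simp: eventually_sequentially intro: less_imp_le)
  \<comment> \<open>Taking the positive part keeps the excess nonnegative, so that in
    \<open>bound\<close> the factor \<open>1 - t k\<close> may be replaced by the larger
    exponential.\<close>
  define p where "p k = max 0 (a k - e / 2)" for k
  define S where "S n = (\<Sum>k<n. t k)" for n
  have step: "p (Suc k) \<le> (1 - t k) * p k" if "k \<ge> N" for k
  proof -
    have "t k * c k \<le> t k * (e / 2)"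
      using N[OF that] t(1) by (intro mult_left_mono) auto
    with rec[of k] have "a (Suc k) - e / 2 \<le> (1 - t k) * (a k - e / 2)"
      by (simp add: algebra_simps diff_divide_distrib)
    also have "\<dots> \<le> (1 - t k) * p k"
      unfolding p_def using t(2)[of k] by (intro mult_left_mono) auto
    finally have "a (Suc k) - e / 2 \<le> (1 - t k) * p k" .
    moreover have "0 \<le> (1 - t k) * p k"
      unfolding p_def using t(2)[of k] by (intro mult_nonneg_nonneg) auto
    ultimately show ?thesis by (simp add: p_def)
  qed
  have bound: "p (N + n) \<le> exp (S N - S (N + n)) * p N" for n
  proof (induction n)
    case (Suc n)
    have "p (N + Suc n) \<le> (1 - t (N + n)) * p (N + n)"
      using step[of "N + n"] by simp
    also have "\<dots> \<le> exp (- t (N + n)) * p (N + n)"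
      using exp_ge_add_one_self[of "- t (N + n)"]
      by (intro mult_right_mono) (auto simp: p_def)
    also have "\<dots> \<le> exp (- t (N + n)) * (exp (S N - S (N + n)) * p N)"
      by (intro mult_left_mono Suc.IH) auto
    also have "\<dots> = exp (S N - S (N + Suc n)) * p N"
      by (simp add: S_def flip: exp_add mult.assoc)
    finally show ?case .
  qed simp
  have "filterlim (\<lambda>n. S (n + N)) at_top sequentially"
    using filterlim_compose[OF div filterlim_add_const_nat_at_top[of N]] by (simp add: S_def)
  then have "filterlim (\<lambda>n. - S N + S (n + N)) at_top sequentially"
    by (rule filterlim_tendsto_add_at_top[OF tendsto_const])
  then have "filterlim (\<lambda>n. S N - S (N + n)) at_bot sequentially"
    by (subst filterlim_uminus_at_bot) (simp add: add.commute)
  then have "(\<lambda>n. exp (S N - S (N + n)) * p N) \<longlonglongrightarrow> 0"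
    by (intro tendsto_mult_left_zero filterlim_compose[OF exp_at_bot])
  then have "\<forall>\<^sub>F n in sequentially. exp (S N - S (N + n)) * p N < e / 2"
    by (rule order_tendstoD(2)) (use e in simp)
  then obtain K where K: "\<And>n. n \<ge> K \<Longrightarrow> exp (S N - S (N + n)) * p N < e / 2"
    unfolding eventually_sequentially by blast
  have "norm (a n - 0) < e" if "n \<ge> N + K" for n
  proof -
    define m where "m = n - N"
    then have m: "n = N + m" "m \<ge> K" using that by auto
    have "p n < e / 2"
      using bound[of m] K[OF m(2)] m(1) by simp
    then show ?thesis using nonneg[of n] unfolding p_def by (simp add: max_def split: if_splits)
  qed
  then show "\<exists>no. \<forall>n\<ge>no. norm (a n - 0) < e" by blast
qed

text \<open>Otherwise some subsequence keeps a fixed distance from \<open>s\<close>; by compactness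
  it has a convergent subsequence, whose limit must be \<open>s\<close>.\<close>

lemma tendsto_unique_subseq_limit:
  fixes y :: "nat \<Rightarrow> 'a::metric_space"
  assumes X: "compact X" "\<And>k. y k \<in> X"
    and uniq: "\<And>r l. strict_mono r \<Longrightarrow> (y \<circ> r) \<longlonglongrightarrow> l \<Longrightarrow> l = s"
  shows "y \<longlonglongrightarrow> s"
proof (rule ccontr)
  assume "\<not> y \<longlonglongrightarrow> s"
  then obtain e where e: "e > 0" "\<forall>N. \<exists>n\<ge>N. dist (y n) s \<ge> e"
    unfolding lim_sequentially by (meson not_less)
  then have "infinite {n. dist (y n) s \<ge> e}"
    by (simp add: infinite_nat_iff_unbounded_le)
  then obtain r where r: "strict_mono (r :: nat \<Rightarrow> nat)" "\<And>n. dist (y (r n)) s \<ge> e"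
    using infinite_enumerate[of "{n. dist (y n) s \<ge> e}"] by auto
  obtain l r' where l: "strict_mono (r' :: nat \<Rightarrow> nat)" "((y \<circ> r) \<circ> r') \<longlonglongrightarrow> l"
    using seq_compactE[OF compact_imp_seq_compact[OF X(1)], of "y \<circ> r"] X(2) by (metis comp_apply)
  then have "l = s"
    using uniq[of "r \<circ> r'" l] r(1) by (simp add: strict_mono_o o_assoc)
  with l(2) e(1) obtain n where "dist (y (r (r' n))) s < e"
    unfolding lim_sequentially by auto
  with r(2) show False by (meson not_less)
qed

section \<open>Projections onto closed convex sets\<close>

lemma norm_closest_point_diff_le:
  fixes X :: "'a::euclidean_space set"
  assumes "X \<noteq> {}" "closed X" "convex X"
  shows "norm (closest_point X u - closest_point X v) \<le> norm (u - v)"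
  using closest_point_lipschitz[OF assms(3,2,1)] by (simp add: dist_norm)

lemma projected_contraction_fixpoint:
  fixes X :: "'a::euclidean_space set"
  assumes X: "X \<noteq> {}" "closed X" "convex X"
    and "c < 1" and T: "\<And>u v. u \<in> X \<Longrightarrow> v \<in> X \<Longrightarrow> norm (T u - T v) \<le> c * norm (u - v)"
  obtains p where "p \<in> X" "closest_point X (T p) = p"
proof -
  have "\<exists>!p\<in>X. closest_point X (T p) = p"
  \<comment> \<open>Banach's theorem asks for a nonnegative factor, while the sign of
    \<open>c\<close> is left open.\<close>
  proof (rule Banach_fix[where c = "max 0 c"])
    show "complete X" using X(2) by (simp add: complete_eq_closed)
    show "(\<lambda>p. closest_point X (T p)) ` X \<subseteq> X"
      using X by (auto intro: closest_point_in_set)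
  next
    fix u v assume uv: "u \<in> X" "v \<in> X"
    have "norm (closest_point X (T u) - closest_point X (T v)) \<le> norm (T u - T v)"
      by (rule norm_closest_point_diff_le[OF X])
    also have "\<dots> \<le> c * norm (u - v)" by (rule T[OF uv])
    also have "\<dots> \<le> max 0 c * norm (u - v)" by (intro mult_right_mono) auto
    finally show "dist (closest_point X (T u)) (closest_point X (T v)) \<le> max 0 c * dist u v"
      by (simp add: dist_norm)
  qed (use assms in auto)
  then show thesis using that by blast
qed

text \<open>The residual of a projection makes a non-acute angle with every direction into
  \<open>X\<close>; at a fixed point this residual is \<open>- c *\<^sub>R G p\<close>.\<close>

lemma projected_step_fixpoint_VI:
  fixes X :: "'a::euclidean_space set"
  assumes X: "X \<noteq> {}" "closed X" "convex X"
    and fp: "closest_point X (p - c *\<^sub>R G p) = p" and "c > 0"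
  shows "p \<in> VI_solutions X G"
proof -
  have "p \<in> X" using closest_point_in_set[OF X(2,1)] fp by metis
  moreover have "(y - p) \<bullet> G p \<ge> 0" if "y \<in> X" for y
  proof -
    have "- (c * ((y - p) \<bullet> G p)) \<le> 0"
      using closest_point_dot[OF X(3,2) that, of "p - c *\<^sub>R G p"] fp by (simp add: inner_commute)
    then show ?thesis using \<open>c > 0\<close> by (simp add: zero_le_mult_iff)
  qed
  ultimately show ?thesis by (simp add: VI_solutions_def)
qed

section \<open>Gradients of convex functions\<close>

lemma DERIV_along_line:
  fixes g :: "'a::euclidean_space \<Rightarrow> real"
  assumes "\<And>u. g differentiable (at u)"
  shows "((\<lambda>t. g (u + t *\<^sub>R d)) has_real_derivative gradient g (u + t *\<^sub>R d) \<bullet> d) (at t)"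
proof -
  have "(g has_derivative (\<lambda>h. h \<bullet> gradient g (u + t *\<^sub>R d))) (at (u + t *\<^sub>R d))"
    using GDERIV_gradient[OF assms] by (simp add: gderiv_def)
  moreover have "((\<lambda>t. u + t *\<^sub>R d) has_derivative (\<lambda>h. h *\<^sub>R d)) (at t)"
    by (auto intro!: derivative_eq_intros)
  ultimately have "((\<lambda>t. g (u + t *\<^sub>R d)) has_derivative
      (\<lambda>h. (h *\<^sub>R d) \<bullet> gradient g (u + t *\<^sub>R d))) (at t)"
    using has_derivative_compose by blast
  moreover have "(\<lambda>h. (h *\<^sub>R d) \<bullet> gradient g (u + t *\<^sub>R d)) = (*) (gradient g (u + t *\<^sub>R d) \<bullet> d)"
    by (auto simp: inner_commute)
  ultimately show ?thesis by (simp add: has_field_derivative_def)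
qed

lemma gradient_mean_value:
  fixes g :: "'a::euclidean_space \<Rightarrow> real"
  assumes "\<And>u. g differentiable (at u)"
  obtains s where "0 < s" "s < 1" "g v - g u = gradient g (u + s *\<^sub>R (v - u)) \<bullet> (v - u)"
proof -
  obtain s where "0 < s" "s < 1" and s: "g (u + 1 *\<^sub>R (v - u)) - g (u + 0 *\<^sub>R (v - u))
      = (1 - 0) * (gradient g (u + s *\<^sub>R (v - u)) \<bullet> (v - u))"
    using MVT2[OF zero_less_one, of "\<lambda>t. g (u + t *\<^sub>R (v - u))"
        "\<lambda>t. gradient g (u + t *\<^sub>R (v - u)) \<bullet> (v - u)"] DERIV_along_line[OF assms]
    by blast
  then show thesis using that by simp
qed

text \<open>The mean value theorem turns the increment of \<open>g\<close> into a slope at an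
  intermediate point, and by monotonicity this slope is at least the one at
  \<open>u\<close>.\<close>

lemma convex_gradient_ineq:
  fixes g :: "'a::euclidean_space \<Rightarrow> real"
  assumes diff: "\<And>u. g differentiable (at u)" and mono: "monotone_map_on UNIV (gradient g)"
  shows "g v \<ge> g u + gradient g u \<bullet> (v - u)"
proof -
  obtain s where s: "0 < s" "g v - g u = gradient g (u + s *\<^sub>R (v - u)) \<bullet> (v - u)"
    using gradient_mean_value[OF diff] by blast
  have "0 \<le> s * ((gradient g (u + s *\<^sub>R (v - u)) - gradient g u) \<bullet> (v - u))"
    using mono[unfolded monotone_map_on_def, rule_format, of "u + s *\<^sub>R (v - u)" u] by simp
  then show ?thesis using s by (simp add: zero_le_mult_iff inner_diff_left)
qed

lemma strongly_convex_gradient_ineq: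
  fixes g :: "'a::euclidean_space \<Rightarrow> real"
  assumes sc: "strongly_convex \<eta> g" and "\<eta> > 0" "u \<noteq> v"
  shows "g v > g u + gradient g u \<bullet> (v - u)"
proof -
  have "\<And>u. g differentiable (at u)" using sc by (simp add: strongly_convex_def)
  then obtain s where s: "0 < s" "g v - g u = gradient g (u + s *\<^sub>R (v - u)) \<bullet> (v - u)"
    by (rule gradient_mean_value)
  have "\<eta> * (norm (s *\<^sub>R (v - u)))\<^sup>2 \<le> s * ((gradient g (u + s *\<^sub>R (v - u)) - gradient g u) \<bullet> (v - u))"
    using sc[unfolded strongly_convex_def, THEN conjunct2, rule_format, of "u + s *\<^sub>R (v - u)" u] by simp
  moreover have "0 < \<eta> * (norm (s *\<^sub>R (v - u)))\<^sup>2"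
    using assms s(1) by simp
  ultimately have "0 < s * ((gradient g (u + s *\<^sub>R (v - u)) - gradient g u) \<bullet> (v - u))"
    by linarith
  then show ?thesis using s by (simp add: zero_less_mult_iff inner_diff_left)
qed

lemma strongly_convex_imp_monotone_gradient:
  assumes "strongly_convex \<eta> g" "\<eta> \<ge> 0"
  shows "monotone_map_on UNIV (gradient g)"
proof -
  have "0 \<le> (gradient g u - gradient g v) \<bullet> (u - v)" for u v
    by (rule order.trans[of _ "\<eta> * (norm (u - v))\<^sup>2"]) (use assms in \<open>auto simp: strongly_convex_def\<close>)
  then show ?thesis by (simp add: monotone_map_on_def)
qed

text \<open>Along the segment, the gap between \<open>g\<close> and its quadratic upper model has a
  nonpositive derivative: the slope drifts by at most
  \<open>L * t * (norm d)\<^sup>2\<close>.\<close>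

lemma lipschitz_gradient_descent:
  fixes g :: "'a::euclidean_space \<Rightarrow> real"
  assumes diff: "\<And>u. g differentiable (at u)" and lip: "L-lipschitz_on UNIV (gradient g)"
  shows "g (u + d) \<le> g u + gradient g u \<bullet> d + L / 2 * (norm d)\<^sup>2"
proof -
  define \<psi> where "\<psi> t = g (u + t *\<^sub>R d) - t * (gradient g u \<bullet> d) - L / 2 * t\<^sup>2 * (norm d)\<^sup>2" for t
  have "\<psi> 1 \<le> \<psi> 0"
  proof (rule DERIV_nonpos_imp_nonincreasing[where a = 0 and b = 1 and f = \<psi>])
    fix t :: real assume t: "0 \<le> t" "t \<le> 1"
    let ?D = "gradient g (u + t *\<^sub>R d) \<bullet> d - gradient g u \<bullet> d - L * t * (norm d)\<^sup>2"
    have "(\<psi> has_real_derivative ?D) (at t)"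
      unfolding \<psi>_def by (auto intro!: derivative_eq_intros DERIV_along_line[OF diff])
    moreover have "?D \<le> 0"
    proof -
      have "gradient g (u + t *\<^sub>R d) \<bullet> d - gradient g u \<bullet> d
          \<le> norm (gradient g (u + t *\<^sub>R d) - gradient g u) * norm d"
        using norm_cauchy_schwarz[of "gradient g (u + t *\<^sub>R d) - gradient g u" d]
        by (simp add: inner_diff_left)
      also have "\<dots> \<le> (L * (t * norm d)) * norm d"
        using lipschitz_onD[OF lip, of "u + t *\<^sub>R d" u] t
        by (intro mult_right_mono) (auto simp: dist_norm)
      finally show ?thesis by (simp add: power2_eq_square mult.assoc)
    qed
    ultimately show "\<exists>y. (\<psi> has_real_derivative y) (at t) \<and> y \<le> 0" by blast
  qed simp
  then show ?thesis by (simp add: \<psi>_def)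
qed

text \<open>
  The Baillon--Haddad inequality: \<open>g - (gradient g v) \<bullet> (\<cdot>)\<close> is minimal at \<open>v\<close>; compare its value
  there with its value after a gradient step of length \<open>1 / L\<close> from \<open>u\<close>, and symmetrise.
\<close>

lemma gradient_cocoercive:
  fixes g :: "'a::euclidean_space \<Rightarrow> real"
  assumes diff: "\<And>u. g differentiable (at u)" and mono: "monotone_map_on UNIV (gradient g)"
    and lip: "L-lipschitz_on UNIV (gradient g)" and "L > 0"
  shows "(norm (gradient g u - gradient g v))\<^sup>2 \<le> L * ((gradient g u - gradient g v) \<bullet> (u - v))"
proof -
  have half: "(norm (gradient g u - gradient g v))\<^sup>2 / (2 * L)
      \<le> g u - g v - gradient g v \<bullet> (u - v)" for u v
  proof -
    define D where "D = gradient g u - gradient g v"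
    define d where "d = - (1 / L) *\<^sub>R D"
    have "g v + gradient g v \<bullet> (u + d - v) \<le> g (u + d)"
      by (rule convex_gradient_ineq[OF diff mono])
    also have "\<dots> \<le> g u + gradient g u \<bullet> d + L / 2 * (norm d)\<^sup>2"
      by (rule lipschitz_gradient_descent[OF diff lip])
    finally have "0 \<le> g u - g v - gradient g v \<bullet> (u - v) + D \<bullet> d + L / 2 * (norm d)\<^sup>2"
      unfolding D_def by (simp add: inner_diff_left inner_diff_right inner_add_right algebra_simps)
    moreover have "D \<bullet> d + L / 2 * (norm d)\<^sup>2 = - ((norm D)\<^sup>2 / (2 * L))"
      using \<open>L > 0\<close> by (simp add: d_def power_mult_distrib dot_square_norm power2_eq_square field_simps)
    ultimately show ?thesis by (simp add: D_def)
  qed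
  have "(norm (gradient g u - gradient g v))\<^sup>2 / L \<le> (gradient g u - gradient g v) \<bullet> (u - v)"
    using half[of u v] half[of v u]
    by (simp add: norm_minus_commute inner_diff_left inner_diff_right)
  then show ?thesis using \<open>L > 0\<close> by (simp add: divide_le_eq mult.commute)
qed

section \<open>Linear convergence of the projected gradient method\<close>

text \<open>Expand the square. Cocoercivity bounds the quadratic term in \<open>D\<close> by
  \<open>\<gamma>\<^sup>2 * L * (D \<bullet> (u - v))\<close>, so that a net decrease
  \<open>\<gamma> * (2 - \<gamma> * L) * (D \<bullet> (u - v))\<close> remains, and strong convexity
  bounds it from below.\<close>

lemma gradient_step_contraction:
  fixes g :: "'a::euclidean_space \<Rightarrow> real"
  assumes sc: "strongly_convex \<eta> g" and "\<eta> \<ge> 0"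
    and lip: "L-lipschitz_on UNIV (gradient g)" and L: "L > 0"
    and \<gamma>: "0 \<le> \<gamma>" "\<gamma> * L \<le> 2"
  shows "norm ((u - \<gamma> *\<^sub>R gradient g u) - (v - \<gamma> *\<^sub>R gradient g v))
    \<le> sqrt (1 - \<gamma> * \<eta> * (2 - \<gamma> * L)) * norm (u - v)"
proof -
  define D where "D = gradient g u - gradient g v"
  have diff: "\<And>u. g differentiable (at u)" using sc by (simp add: strongly_convex_def)
  have co: "(norm D)\<^sup>2 \<le> L * (D \<bullet> (u - v))"
    unfolding D_def
    by (rule gradient_cocoercive[OF diff strongly_convex_imp_monotone_gradient[OF sc \<open>\<eta> \<ge> 0\<close>] lip L])
  have str: "\<eta> * (norm (u - v))\<^sup>2 \<le> D \<bullet> (u - v)"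
    using sc by (simp add: strongly_convex_def D_def)
  have "(norm ((u - v) - \<gamma> *\<^sub>R D))\<^sup>2
      = (norm (u - v))\<^sup>2 - 2 * \<gamma> * (D \<bullet> (u - v)) + \<gamma>\<^sup>2 * (norm D)\<^sup>2"
    unfolding power2_norm_eq_inner
    by (simp add: inner_diff_left inner_diff_right inner_commute power2_eq_square algebra_simps)
  also have "\<dots> \<le> (norm (u - v))\<^sup>2 - 2 * \<gamma> * (D \<bullet> (u - v)) + \<gamma>\<^sup>2 * (L * (D \<bullet> (u - v)))"
    using co by (intro add_left_mono mult_left_mono) auto
  also have "\<dots> = (norm (u - v))\<^sup>2 - \<gamma> * (2 - \<gamma> * L) * (D \<bullet> (u - v))"
    by (simp add: algebra_simps power2_eq_square)
  also have "\<dots> \<le> (norm (u - v))\<^sup>2 - \<gamma> * (2 - \<gamma> * L) * (\<eta> * (norm (u - v))\<^sup>2)"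
    using str \<gamma> by (intro diff_left_mono mult_left_mono) auto
  also have "\<dots> = (1 - \<gamma> * \<eta> * (2 - \<gamma> * L)) * (norm (u - v))\<^sup>2"
    by (simp add: algebra_simps)
  finally have "norm ((u - v) - \<gamma> *\<^sub>R D) \<le> sqrt ((1 - \<gamma> * \<eta> * (2 - \<gamma> * L)) * (norm (u - v))\<^sup>2)"
    by (rule real_le_rsqrt)
  then have "norm ((u - v) - \<gamma> *\<^sub>R D) \<le> sqrt (1 - \<gamma> * \<eta> * (2 - \<gamma> * L)) * norm (u - v)"
    by (simp add: real_sqrt_mult)
  moreover have "(u - v) - \<gamma> *\<^sub>R D = (u - \<gamma> *\<^sub>R gradient g u) - (v - \<gamma> *\<^sub>R gradient g v)"
    by (simp add: D_def algebra_simps)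
  ultimately show ?thesis by simp
qed

text \<open>The inequality at \<open>s\<close> makes the linear part of \<open>g\<close> nonnegative
  towards \<open>\<Theta>\<close>, and the strict gradient inequality does the rest.\<close>

lemma strongly_convex_VI_imp_arg_min:
  fixes g :: "'a::euclidean_space \<Rightarrow> real"
  assumes sc: "strongly_convex \<eta> g" "\<eta> > 0" and s: "s \<in> VI_solutions \<Theta> (gradient g)"
  shows "{t. is_arg_min g (\<lambda>t. t \<in> \<Theta>) t} = {s}"
proof -
  have "g s < g t" if "t \<in> \<Theta>" "t \<noteq> s" for t
  proof -
    have "0 \<le> gradient g s \<bullet> (t - s)"
      using s that(1) by (simp add: VI_solutions_def inner_commute)
    also have "\<dots> < g t - g s"
      using strongly_convex_gradient_ineq[OF sc, of s t] that(2) by auto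
    finally show ?thesis by simp
  qed
  moreover have "s \<in> \<Theta>" using s by (simp add: VI_solutions_def)
  ultimately show ?thesis
    unfolding is_arg_min_def by (auto dest: less_asym)
qed

text \<open>Projection preserves the contraction factor. The fixed point of the step solves the
  variational inequality of the gradient, hence is the minimizer; iterating the contraction gives
  the rate.\<close>

lemma projected_gradient_converges:
  fixes g :: "'a::euclidean_space \<Rightarrow> real"
  assumes \<Theta>: "\<Theta> \<noteq> {}" "closed \<Theta>" "convex \<Theta>"
    and sc: "strongly_convex \<eta> g" "\<eta> > 0"
    and lip: "L-lipschitz_on UNIV (gradient g)" "L > 0"
    and \<gamma>: "0 < \<gamma>" "\<gamma> * L < 2"
    and q: "q = sqrt (1 - \<gamma> * \<eta> * (2 - \<gamma> * L))"
    and \<theta>: "\<And>k. \<theta> (Suc k) = closest_point \<Theta> (\<theta> k - \<gamma> *\<^sub>R gradient g (\<theta> k))"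
  obtains s where "s \<in> \<Theta>" "{t. is_arg_min g (\<lambda>t. t \<in> \<Theta>) t} = {s}" "\<theta> \<longlonglongrightarrow> s"
    "\<And>k. norm (\<theta> k - s) \<le> q ^ k * norm (\<theta> 0 - s)"
proof -
  have contr: "norm ((u - \<gamma> *\<^sub>R gradient g u) - (v - \<gamma> *\<^sub>R gradient g v)) \<le> q * norm (u - v)" for u v
    unfolding q using gradient_step_contraction[OF sc(1) _ lip] sc(2) \<gamma> by simp
  have "q < 1" unfolding q using sc(2) \<gamma> by simp
  \<comment> \<open>\<open>sqrt\<close> is negative at negative arguments, so
    \<open>0 \<le> q\<close> is read off from the contraction applied to a nonzero vector.\<close>
  obtain b :: 'a where "b \<in> Basis" using nonempty_Basis by blast
  then have "0 \<le> q"
    using order.trans[OF norm_ge_zero contr[of b 0]] by simp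
  obtain s where s: "s \<in> \<Theta>" "closest_point \<Theta> (s - \<gamma> *\<^sub>R gradient g s) = s"
    using projected_contraction_fixpoint[OF \<Theta> \<open>q < 1\<close> contr] by blast
  have rate: "norm (\<theta> k - s) \<le> q ^ k * norm (\<theta> 0 - s)" for k
  proof (induction k)
    case (Suc k)
    have "norm (\<theta> (Suc k) - s)
        \<le> norm ((\<theta> k - \<gamma> *\<^sub>R gradient g (\<theta> k)) - (s - \<gamma> *\<^sub>R gradient g s))"
      using norm_closest_point_diff_le[OF \<Theta>] s(2) \<theta>[of k] by metis
    also have "\<dots> \<le> q * norm (\<theta> k - s)" by (rule contr)
    also have "\<dots> \<le> q * (q ^ k * norm (\<theta> 0 - s))"
      using Suc.IH \<open>0 \<le> q\<close> by (rule mult_left_mono)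
    finally show ?case by (simp add: mult.assoc)
  qed simp
  have "(\<lambda>k. q ^ k * norm (\<theta> 0 - s)) \<longlonglongrightarrow> 0"
    using \<open>0 \<le> q\<close> \<open>q < 1\<close> by (intro tendsto_mult_left_zero LIMSEQ_power_zero) simp
  then have "(\<lambda>k. \<theta> k - s) \<longlonglongrightarrow> 0"
    by (rule Lim_null_comparison[OF always_eventually, rotated]) (use rate in blast)
  then have "\<theta> \<longlonglongrightarrow> s" by (simp add: LIM_zero_iff)
  moreover have "s \<in> VI_solutions \<Theta> (gradient g)"
    using \<Theta> s(2) \<gamma>(1) by (rule projected_step_fixpoint_VI)
  then have "{t. is_arg_min g (\<lambda>t. t \<in> \<Theta>) t} = {s}"
    by (rule strongly_convex_VI_imp_arg_min[OF sc])
  ultimately show thesis using that s(1) rate by blast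
qed

section \<open>Tikhonov regularization of monotone variational inequalities\<close>

text \<open>The regularized map is strongly monotone with constant \<open>\<epsilon>\<close> and
  Lipschitz with constant \<open>L + \<epsilon>\<close>. The bound on \<open>\<gamma>\<close> lets
  the quadratic term use up at most half of the decrease
  \<open>2 * \<gamma> * \<epsilon> * (norm d)\<^sup>2\<close>.\<close>

lemma regularized_step_contraction:
  fixes G :: "'a::real_inner \<Rightarrow> 'a"
  assumes mono: "monotone_map_on X G"
    and lip: "norm (G u - G v) \<le> L * norm (u - v)"
    and uv: "u \<in> X" "v \<in> X" and pos: "\<gamma> > 0" "\<epsilon> > 0" and \<gamma>: "\<gamma> \<le> \<epsilon> / (L + \<epsilon>)\<^sup>2"
  shows "norm ((u - \<gamma> *\<^sub>R (G u + \<epsilon> *\<^sub>R u)) - (v - \<gamma> *\<^sub>R (G v + \<epsilon> *\<^sub>R v)))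
    \<le> sqrt (1 - \<gamma> * \<epsilon>) * norm (u - v)"
proof (cases "u = v")
  case False
  define d where "d = u - v"
  define D where "D = (G u - G v) + \<epsilon> *\<^sub>R d"
  \<comment> \<open>The sign of \<open>L\<close> is only forced by two distinct points, hence the
    case split.\<close>
  have "0 \<le> L * norm (u - v)" using order.trans[OF norm_ge_zero lip] .
  then have "L \<ge> 0" using False by (simp add: zero_le_mult_iff)
  have "norm D \<le> norm (G u - G v) + norm (\<epsilon> *\<^sub>R d)"
    unfolding D_def by (rule norm_triangle_ineq)
  also have "\<dots> \<le> (L + \<epsilon>) * norm d"
    using lip pos by (simp add: d_def distrib_right)
  finally have "(norm D)\<^sup>2 \<le> ((L + \<epsilon>) * norm d)\<^sup>2" by (simp add: power_mono)
  then have "\<gamma> * (norm D)\<^sup>2 \<le> \<gamma> * (L + \<epsilon>)\<^sup>2 * (norm d)\<^sup>2"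
    using pos by (simp add: power_mult_distrib mult.assoc)
  also have "\<gamma> * (L + \<epsilon>)\<^sup>2 \<le> \<epsilon>"
    using \<gamma> \<open>L \<ge> 0\<close> pos by (simp add: le_divide_eq)
  finally have D: "\<gamma> * (norm D)\<^sup>2 \<le> \<epsilon> * (norm d)\<^sup>2"
    by (simp add: mult_right_mono)
  have "0 \<le> (G u - G v) \<bullet> d"
    using mono uv by (simp add: monotone_map_on_def d_def)
  then have Dd: "\<epsilon> * (norm d)\<^sup>2 \<le> D \<bullet> d"
    by (simp add: D_def inner_add_left power2_norm_eq_inner)
  have "(norm (d - \<gamma> *\<^sub>R D))\<^sup>2 = (norm d)\<^sup>2 - 2 * \<gamma> * (D \<bullet> d) + \<gamma> * (\<gamma> * (norm D)\<^sup>2)"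
    by (simp add: power2_norm_eq_inner inner_diff_left inner_diff_right inner_commute algebra_simps)
  also have "\<dots> \<le> (norm d)\<^sup>2 - 2 * \<gamma> * (\<epsilon> * (norm d)\<^sup>2) + \<gamma> * (\<epsilon> * (norm d)\<^sup>2)"
    using D Dd pos by (intro add_mono diff_left_mono mult_left_mono) auto
  also have "\<dots> = (1 - \<gamma> * \<epsilon>) * (norm d)\<^sup>2"
    by (simp add: algebra_simps)
  finally have "norm (d - \<gamma> *\<^sub>R D) \<le> sqrt ((1 - \<gamma> * \<epsilon>) * (norm d)\<^sup>2)"
    by (rule real_le_rsqrt)
  then have "norm (d - \<gamma> *\<^sub>R D) \<le> sqrt (1 - \<gamma> * \<epsilon>) * norm d"
    by (simp add: real_sqrt_mult)
  moreover have "d - \<gamma> *\<^sub>R D = (u - \<gamma> *\<^sub>R (G u + \<epsilon> *\<^sub>R u)) - (v - \<gamma> *\<^sub>R (G v + \<epsilon> *\<^sub>R v))"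
    by (simp add: D_def d_def algebra_simps)
  ultimately show ?thesis by (simp only: d_def)
qed simp

text \<open>Test each inequality at the other solution and add: monotonicity removes
  \<open>G\<close>, and only the difference of the regularization terms is left.\<close>

lemma regularized_VI_path_step:
  fixes G :: "'a::real_inner \<Rightarrow> 'a"
  assumes mono: "monotone_map_on X G" and "\<epsilon> > 0"
    and u: "u \<in> VI_solutions X (\<lambda>z. G z + \<delta> *\<^sub>R z)" and v: "v \<in> VI_solutions X (\<lambda>z. G z + \<epsilon> *\<^sub>R z)"
  shows "norm (v - u) \<le> \<bar>\<delta> - \<epsilon>\<bar> / \<epsilon> * norm u"
proof -
  define d where "d = v - u"
  have "0 \<le> (v - u) \<bullet> (G u + \<delta> *\<^sub>R u)" "0 \<le> (u - v) \<bullet> (G v + \<epsilon> *\<^sub>R v)"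
    "0 \<le> (G v - G u) \<bullet> (v - u)"
    using u v mono by (auto simp: VI_solutions_def monotone_map_on_def)
  then have "\<epsilon> * (norm d)\<^sup>2 \<le> (\<delta> - \<epsilon>) * (d \<bullet> u)"
    by (simp add: d_def power2_norm_eq_inner inner_diff_left inner_diff_right inner_add_right
        inner_commute algebra_simps)
  also have "\<dots> \<le> \<bar>\<delta> - \<epsilon>\<bar> * (norm d * norm u)"
    by (rule order.trans[OF abs_ge_self]) (simp add: abs_mult mult_left_mono Cauchy_Schwarz_ineq2)
  finally have *: "norm d * (\<epsilon> * norm d) \<le> norm d * (\<bar>\<delta> - \<epsilon>\<bar> * norm u)"
    by (simp add: power2_eq_square algebra_simps)
  show ?thesis
  proof (cases "d = 0")
    case False
    with * have "\<epsilon> * norm d \<le> \<bar>\<delta> - \<epsilon>\<bar> * norm u" by simp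
    then show ?thesis using \<open>\<epsilon> > 0\<close> by (simp add: d_def field_simps)
  next
    case True
    then have "norm (v - u) = 0" by (simp add: d_def)
    also have "0 \<le> \<bar>\<delta> - \<epsilon>\<bar> / \<epsilon> * norm u" using \<open>\<epsilon> > 0\<close> by simp
    finally show ?thesis .
  qed
qed

text \<open>Every subsequential limit of \<open>y\<close> solves the limit problem and meets the
  first-order condition for least norm. That condition determines the point, so by compactness all
  of \<open>y\<close> converges; existence of a solution comes along.\<close>

lemma regularized_VI_tendsto_least_norm:
  fixes G :: "'a::euclidean_space \<Rightarrow> 'a"
  assumes X: "compact X" and mono: "monotone_map_on X G" and cont: "continuous_on X G"
    and \<epsilon>: "\<And>k. \<epsilon> k > 0" "\<epsilon> \<longlonglongrightarrow> 0"
    and y: "\<And>k. y k \<in> VI_solutions X (\<lambda>z. G z + \<epsilon> k *\<^sub>R z)"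
  obtains s where "{z. is_arg_min norm (\<lambda>z. z \<in> VI_solutions X G) z} = {s}" "y \<longlonglongrightarrow> s"
proof -
  have yX: "y k \<in> X" for k using y by (simp add: VI_solutions_def)
  \<comment> \<open>Adding the three inequalities cancels \<open>G\<close> and leaves a multiple of
    \<open>\<epsilon> k\<close>, which is divided out before the limit is taken.\<close>
  have acute: "0 \<le> (s - y k) \<bullet> y k" if s: "s \<in> VI_solutions X G" for s k
  proof -
    have "0 \<le> (s - y k) \<bullet> (G (y k) + \<epsilon> k *\<^sub>R y k)" "0 \<le> (y k - s) \<bullet> G s"
      "0 \<le> (G s - G (y k)) \<bullet> (s - y k)"
      using s y[of k] mono by (auto simp: VI_solutions_def monotone_map_on_def)
    then have "0 \<le> \<epsilon> k * ((s - y k) \<bullet> y k)"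
      by (simp add: inner_diff_left inner_diff_right inner_add_right inner_commute algebra_simps)
    then show ?thesis using \<epsilon>(1)[of k] by (simp add: zero_le_mult_iff)
  qed
  have lim: "l \<in> VI_solutions X G \<and> (\<forall>s\<in>VI_solutions X G. 0 \<le> (s - l) \<bullet> l)"
    if r: "strict_mono (r :: nat \<Rightarrow> nat)" and l: "(y \<circ> r) \<longlonglongrightarrow> l" for r l
  proof -
    have l': "(\<lambda>n. y (r n)) \<longlonglongrightarrow> l" using l by (simp add: o_def)
    have lX: "l \<in> X"
      by (rule closed_sequentially[OF compact_imp_closed[OF X] yX l'])
    have Gl: "(\<lambda>n. G (y (r n))) \<longlonglongrightarrow> G l"
      using continuous_on_tendsto_compose[OF cont l' lX] yX by simp
    have er: "(\<lambda>n. \<epsilon> (r n)) \<longlonglongrightarrow> 0"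
      using LIMSEQ_subseq_LIMSEQ[OF \<epsilon>(2) r] by (simp add: o_def)
    have "0 \<le> (z - l) \<bullet> G l" if "z \<in> X" for z
    proof (rule tendsto_lowerbound)
      show "(\<lambda>n. (z - y (r n)) \<bullet> (G (y (r n)) + \<epsilon> (r n) *\<^sub>R y (r n))) \<longlonglongrightarrow> (z - l) \<bullet> G l"
        by (rule tendsto_eq_intros l' Gl er refl | simp)+
      show "\<forall>\<^sub>F n in sequentially. 0 \<le> (z - y (r n)) \<bullet> (G (y (r n)) + \<epsilon> (r n) *\<^sub>R y (r n))"
        using y that by (simp add: VI_solutions_def)
    qed simp
    moreover have "0 \<le> (s - l) \<bullet> l" if "s \<in> VI_solutions X G" for s
    proof (rule tendsto_lowerbound)
      show "(\<lambda>n. (s - y (r n)) \<bullet> y (r n)) \<longlonglongrightarrow> (s - l) \<bullet> l"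
        by (intro tendsto_intros l')
    qed (use acute[OF that] in auto)
    ultimately show ?thesis using lX by (simp add: VI_solutions_def)
  qed
  \<comment> \<open>No other solution has norm at most \<open>norm l\<close>. This yields minimality
    and uniqueness of \<open>l\<close> together, and also identifies any two subsequential limits by
    comparing their norms.\<close>
  have uniq: "s = l" if "l \<in> VI_solutions X G" "\<forall>s\<in>VI_solutions X G. 0 \<le> (s - l) \<bullet> l"
    "s \<in> VI_solutions X G" "norm s \<le> norm l" for s l
  proof -
    have "(norm (s - l))\<^sup>2 = (norm s)\<^sup>2 - (norm l)\<^sup>2 - 2 * ((s - l) \<bullet> l)"
      by (simp add: power2_norm_eq_inner inner_diff_left inner_diff_right inner_commute algebra_simps)
    also have "\<dots> \<le> 0"
      using bspec[OF that(2,3)] power_mono[OF that(4) norm_ge_zero, of 2] by linarith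
    finally show ?thesis by simp
  qed
  obtain l r where r: "strict_mono (r :: nat \<Rightarrow> nat)" "(y \<circ> r) \<longlonglongrightarrow> l"
    using seq_compactE[OF compact_imp_seq_compact[OF X], of y] yX by blast
  note l = conjunct1[OF lim[OF r]] conjunct2[OF lim[OF r]]
  have "{z. is_arg_min norm (\<lambda>z. z \<in> VI_solutions X G) z} = {l}"
    using uniq[OF l] l(1) unfolding is_arg_min_def by (auto simp: not_less) (metis linear)
  moreover have "y \<longlonglongrightarrow> l"
  proof (rule tendsto_unique_subseq_limit[OF X yX])
    fix r' l' assume r': "strict_mono (r' :: nat \<Rightarrow> nat)" "(y \<circ> r') \<longlonglongrightarrow> l'"
    note l' = conjunct1[OF lim[OF r']] conjunct2[OF lim[OF r']]
    show "l' = l"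
      using uniq[OF l l'(1)] uniq[OF l' l(1)] linear[of "norm l" "norm l'"] by blast
  qed
  ultimately show thesis using that by blast
qed

section \<open>Convergence of the scheme\<close>

text \<open>Turns the square-root contraction factor into the form \<open>1 - t k\<close> that the
  averaged recursion needs.\<close>

lemma sqrt_one_minus_le: "sqrt (1 - t) \<le> 1 - t / 2" if "t \<le> 1" for t :: real
  using that by (intro real_le_lsqrt) (auto simp: power2_eq_square algebra_simps)

theorem theorem21:
  fixes X :: "(real^'n) set" and \<Theta> :: "(real^'m) set"
    and F :: "real^'n \<Rightarrow> real^'m \<Rightarrow> real^'n" and g :: "real^'m \<Rightarrow> real"
    and \<gamma>\<^sub>f \<epsilon> :: "nat \<Rightarrow> real" and \<gamma>\<^sub>g \<eta>\<^sub>g G\<^sub>g L\<^sub>x L\<^sub>\<theta> q\<^sub>g :: real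
    and x :: "nat \<Rightarrow> real^'n" and \<theta> :: "nat \<Rightarrow> real^'m"
  assumes "X \<noteq> {}" and "closed X" and "convex X" and "compact X"
    and "\<Theta> \<noteq> {}" and "closed \<Theta>" and "convex \<Theta>"
    and "\<eta>\<^sub>g > 0" and "\<And>u. g differentiable (at u)" and "strongly_convex \<eta>\<^sub>g g"
    and "G\<^sub>g-lipschitz_on UNIV (gradient g)"
    and "\<And>t. t \<in> \<Theta> \<Longrightarrow> monotone_map_on X (\<lambda>z. F z t)"
    and "\<And>z\<^sub>1 z\<^sub>2 t. \<lbrakk>z\<^sub>1 \<in> X; z\<^sub>2 \<in> X; t \<in> \<Theta>\<rbrakk> \<Longrightarrow>
           norm (F z\<^sub>1 t - F z\<^sub>2 t) \<le> L\<^sub>x * norm (z\<^sub>1 - z\<^sub>2)"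
    and "\<And>z t\<^sub>1 t\<^sub>2. \<lbrakk>t\<^sub>1 \<in> \<Theta>; t\<^sub>2 \<in> \<Theta>; z \<in> X\<rbrakk> \<Longrightarrow>
           norm (F z t\<^sub>1 - F z t\<^sub>2) \<le> L\<^sub>\<theta> * norm (t\<^sub>1 - t\<^sub>2)"
    and "\<And>k. \<gamma>\<^sub>f k > 0" and "\<And>k. \<epsilon> k > 0" and "\<epsilon> \<longlonglongrightarrow> 0"
    and "\<And>k. \<gamma>\<^sub>f k \<le> \<epsilon> k / (L\<^sub>x + \<epsilon> k)\<^sup>2"
    and "\<And>k. \<epsilon> k / (L\<^sub>x + \<epsilon> k)\<^sup>2 \<le> \<epsilon> 0 / L\<^sub>x\<^sup>2"
    and "\<And>k. \<gamma>\<^sub>f k * \<epsilon> k < 1"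
    and "filterlim (\<lambda>N. \<Sum>k=1..N. \<gamma>\<^sub>f k * \<epsilon> k) at_top sequentially"
    and "(\<lambda>k. \<bar>\<epsilon> (k - 1) - \<epsilon> k\<bar> / (\<gamma>\<^sub>f k * (\<epsilon> k)\<^sup>2)) \<longlonglongrightarrow> 0"
    and "0 < \<gamma>\<^sub>g" and "\<gamma>\<^sub>g < 2 / G\<^sub>g"
    and "q\<^sub>g = sqrt (1 - \<gamma>\<^sub>g * \<eta>\<^sub>g * (2 - \<gamma>\<^sub>g * G\<^sub>g))"
    and "(\<lambda>k. q\<^sub>g ^ k / \<epsilon> k) \<longlonglongrightarrow> 0"
    and "(\<lambda>k. q\<^sub>g ^ (k - 1) / (\<gamma>\<^sub>f k * (\<epsilon> k)\<^sup>2)) \<longlonglongrightarrow> 0"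
    and "regularized_projection_scheme X \<Theta> F g \<gamma>\<^sub>f (\<lambda>_. \<gamma>\<^sub>g) \<epsilon> x \<theta>"
  shows "\<exists>\<theta>\<^sub>s x\<^sub>s.
           {t. is_arg_min g (\<lambda>t. t \<in> \<Theta>) t} = {\<theta>\<^sub>s} \<and>
           {z. is_arg_min norm (\<lambda>z. z \<in> VI_solutions X (\<lambda>z. F z \<theta>\<^sub>s)) z} = {x\<^sub>s} \<and>
           \<theta> \<longlonglongrightarrow> \<theta>\<^sub>s \<and> x \<longlonglongrightarrow> x\<^sub>s"
proof -
  note X = assms(1-3) and \<Theta> = assms(5-7) and mono = assms(12) and lip_x = assms(13)
    and lip_\<theta> = assms(14) and \<gamma>_pos = assms(15) and \<epsilon>_pos = assms(16) and \<gamma>_le = assms(18)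
    and \<gamma>\<epsilon> = assms(20)
  have x0: "x 0 \<in> X" "\<theta> 0 \<in> \<Theta>"
    and x_Suc: "\<And>k. x (Suc k) = closest_point X (x k - \<gamma>\<^sub>f k *\<^sub>R (F (x k) (\<theta> k) + \<epsilon> k *\<^sub>R x k))"
    and \<theta>_Suc: "\<And>k. \<theta> (Suc k) = closest_point \<Theta> (\<theta> k - \<gamma>\<^sub>g *\<^sub>R gradient g (\<theta> k))"
    using assms(28) unfolding regularized_projection_scheme_def by auto
  have xX: "x k \<in> X" for k
    by (cases k) (use x0 x_Suc X closest_point_in_set in auto)
  have \<theta>\<Theta>: "\<theta> k \<in> \<Theta>" for k
    by (cases k) (use x0 \<theta>_Suc \<Theta> closest_point_in_set in auto)

  \<comment> \<open>The case \<open>G\<^sub>g = 0\<close> is excluded because then \<open>2 / G\<^sub>g = 0\<close>.\<close>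
  have "G\<^sub>g \<ge> 0" using assms(11) lipschitz_on_nonneg by blast
  with assms(23,24) have G: "G\<^sub>g > 0" by (cases "G\<^sub>g = 0") auto
  with assms(24) have "\<gamma>\<^sub>g * G\<^sub>g < 2" by (simp add: field_simps)
  with \<Theta> assms(10,8,11) G assms(23)
  obtain \<theta>\<^sub>s where \<theta>\<^sub>s: "\<theta>\<^sub>s \<in> \<Theta>" "{t. is_arg_min g (\<lambda>t. t \<in> \<Theta>) t} = {\<theta>\<^sub>s}" "\<theta> \<longlonglongrightarrow> \<theta>\<^sub>s"
    and rate: "\<And>k. norm (\<theta> k - \<theta>\<^sub>s) \<le> q\<^sub>g ^ k * norm (\<theta> 0 - \<theta>\<^sub>s)"
    using assms(25) \<theta>_Suc by (rule projected_gradient_converges) blast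

  have contr: "norm ((u - \<gamma>\<^sub>f k *\<^sub>R (F u \<theta>\<^sub>s + \<epsilon> k *\<^sub>R u)) - (v - \<gamma>\<^sub>f k *\<^sub>R (F v \<theta>\<^sub>s + \<epsilon> k *\<^sub>R v)))
      \<le> sqrt (1 - \<gamma>\<^sub>f k * \<epsilon> k) * norm (u - v)" if "u \<in> X" "v \<in> X" for u v k
    by (rule regularized_step_contraction[OF mono[OF \<theta>\<^sub>s(1)] lip_x[OF that \<theta>\<^sub>s(1)] that
          \<gamma>_pos \<epsilon>_pos \<gamma>_le])
  \<comment> \<open>The Tikhonov point is obtained as the fixed point of the scheme's own step with
    \<open>\<theta>\<^sub>s\<close> in place of \<open>\<theta> k\<close>, so one step of
    \<open>x\<close> can be compared with it directly.\<close>
  have "\<exists>p. p \<in> X \<and> closest_point X (p - \<gamma>\<^sub>f k *\<^sub>R (F p \<theta>\<^sub>s + \<epsilon> k *\<^sub>R p)) = p" for k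
    using projected_contraction_fixpoint[OF X _ contr] \<gamma>_pos[of k] \<epsilon>_pos[of k]
    by (metis (no_types, lifting) diff_less_eq less_add_same_cancel1 mult_pos_pos real_sqrt_lt_1_iff)
  then obtain y where yX: "\<And>k. y k \<in> X"
    and y_fix: "\<And>k. closest_point X (y k - \<gamma>\<^sub>f k *\<^sub>R (F (y k) \<theta>\<^sub>s + \<epsilon> k *\<^sub>R y k)) = y k"
    by metis
  have y: "y k \<in> VI_solutions X (\<lambda>z. F z \<theta>\<^sub>s + \<epsilon> k *\<^sub>R z)" for k
    using X y_fix \<gamma>_pos by (rule projected_step_fixpoint_VI)
  have cont: "continuous_on X (\<lambda>z. F z \<theta>\<^sub>s)"
  proof (rule lipschitz_on_continuous_on)
    \<comment> \<open>A Lipschitz constant must be nonnegative here, and the sign of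
      \<open>L\<^sub>x\<close> is not given; likewise for \<open>L\<^sub>\<theta>\<close> in
      \<open>C\<close> below.\<close>
    show "\<bar>L\<^sub>x\<bar>-lipschitz_on X (\<lambda>z. F z \<theta>\<^sub>s)"
      using lip_x \<theta>\<^sub>s(1) by (intro lipschitz_onI)
        (auto simp: dist_norm intro: order.trans[OF _ mult_right_mono[OF abs_ge_self]])
  qed
  obtain x\<^sub>s where x\<^sub>s: "{z. is_arg_min norm (\<lambda>z. z \<in> VI_solutions X (\<lambda>z. F z \<theta>\<^sub>s)) z} = {x\<^sub>s}"
    and y_lim: "y \<longlonglongrightarrow> x\<^sub>s"
    using regularized_VI_tendsto_least_norm[OF assms(4) mono[OF \<theta>\<^sub>s(1)] cont \<epsilon>_pos assms(17) y]
    by blast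
  obtain M where M: "\<And>z. z \<in> X \<Longrightarrow> norm z \<le> M"
    using compact_imp_bounded[OF assms(4)] by (auto simp: bounded_iff)

  define C where "C = \<bar>L\<^sub>\<theta>\<bar> * norm (\<theta> 0 - \<theta>\<^sub>s)"
  \<comment> \<open>\<open>y k\<close> is the target of the step that produces
    \<open>x (Suc k)\<close>. Putting \<open>Suc k\<close> into \<open>t\<close> and
    \<open>c\<close> avoids the truncated \<open>k - 1\<close> at 0.\<close>
  define a where "a k = norm (x (Suc k) - y k)" for k
  define t where "t k = \<gamma>\<^sub>f (Suc k) * \<epsilon> (Suc k) / 2" for k
  \<comment> \<open>The two errors divided by \<open>t k\<close>: the drift of the Tikhonov point,
    and the parameter error.\<close>
  define c where "c k = 2 * M * (\<bar>\<epsilon> k - \<epsilon> (Suc k)\<bar> / (\<gamma>\<^sub>f (Suc k) * (\<epsilon> (Suc k))\<^sup>2))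
    + 2 * C * (q\<^sub>g ^ Suc k / \<epsilon> (Suc k))" for k
  have t: "0 \<le> t k" "t k \<le> 1" for k
    using \<gamma>_pos[of "Suc k"] \<epsilon>_pos[of "Suc k"] \<gamma>\<epsilon>[of "Suc k"] by (auto simp: t_def)
  have step: "norm (x (Suc k) - y k)
      \<le> (1 - \<gamma>\<^sub>f k * \<epsilon> k / 2) * norm (x k - y k) + \<gamma>\<^sub>f k * (C * q\<^sub>g ^ k)" for k
  proof -
    let ?T = "\<lambda>z. z - \<gamma>\<^sub>f k *\<^sub>R (F z \<theta>\<^sub>s + \<epsilon> k *\<^sub>R z)"
    have "norm (x (Suc k) - y k)
        \<le> norm ((x k - \<gamma>\<^sub>f k *\<^sub>R (F (x k) (\<theta> k) + \<epsilon> k *\<^sub>R x k)) - ?T (y k))"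
      using norm_closest_point_diff_le[OF X] x_Suc[of k] y_fix[of k] by metis
    \<comment> \<open>Splits off the error of using \<open>\<theta> k\<close> instead of
      \<open>\<theta>\<^sub>s\<close>; the remainder is a contraction.\<close>
    also have "\<dots> = norm ((?T (x k) - ?T (y k)) - \<gamma>\<^sub>f k *\<^sub>R (F (x k) (\<theta> k) - F (x k) \<theta>\<^sub>s))"
      by (simp add: algebra_simps)
    also have "\<dots> \<le> norm (?T (x k) - ?T (y k)) + \<gamma>\<^sub>f k * norm (F (x k) (\<theta> k) - F (x k) \<theta>\<^sub>s)"
      using norm_triangle_ineq4[of "?T (x k) - ?T (y k)" "\<gamma>\<^sub>f k *\<^sub>R (F (x k) (\<theta> k) - F (x k) \<theta>\<^sub>s)"]
        \<gamma>_pos[of k] by simp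
    also have "\<dots> \<le> (1 - \<gamma>\<^sub>f k * \<epsilon> k / 2) * norm (x k - y k) + \<gamma>\<^sub>f k * (C * q\<^sub>g ^ k)"
    proof (intro add_mono mult_left_mono)
      show "norm (?T (x k) - ?T (y k)) \<le> (1 - \<gamma>\<^sub>f k * \<epsilon> k / 2) * norm (x k - y k)"
        using \<gamma>\<epsilon>[of k]
        by (intro order.trans[OF contr[OF xX yX]] mult_right_mono sqrt_one_minus_le) auto
      have "norm (F (x k) (\<theta> k) - F (x k) \<theta>\<^sub>s) \<le> L\<^sub>\<theta> * norm (\<theta> k - \<theta>\<^sub>s)"
        by (rule lip_\<theta>[OF \<theta>\<Theta> \<theta>\<^sub>s(1) xX])
      also have "\<dots> \<le> \<bar>L\<^sub>\<theta>\<bar> * norm (\<theta> k - \<theta>\<^sub>s)"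
        by (intro mult_right_mono) auto
      also have "\<dots> \<le> \<bar>L\<^sub>\<theta>\<bar> * (q\<^sub>g ^ k * norm (\<theta> 0 - \<theta>\<^sub>s))"
        by (intro mult_left_mono rate) auto
      finally show "norm (F (x k) (\<theta> k) - F (x k) \<theta>\<^sub>s) \<le> C * q\<^sub>g ^ k"
        by (simp add: C_def mult_ac)
    qed (use \<gamma>_pos[of k] in simp)
    finally show ?thesis .
  qed
  have rec: "a (Suc k) \<le> (1 - t k) * a k + t k * c k" for k
  proof -
    let ?j = "Suc k"
    define \<delta> where "\<delta> = \<bar>\<epsilon> k - \<epsilon> ?j\<bar> / \<epsilon> ?j * M"
    have pos: "\<gamma>\<^sub>f ?j > 0" "\<epsilon> ?j > 0" by (rule \<gamma>_pos \<epsilon>_pos)+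
    have "norm (y ?j - y k) \<le> \<bar>\<epsilon> k - \<epsilon> ?j\<bar> / \<epsilon> ?j * norm (y k)"
      by (rule regularized_VI_path_step[OF mono[OF \<theta>\<^sub>s(1)] pos(2) y y])
    also have "\<dots> \<le> \<delta>"
      unfolding \<delta>_def using M[OF yX] pos by (intro mult_left_mono) auto
    finally have "norm (x ?j - y ?j) \<le> a k + \<delta>"
      using norm_triangle_ineq4[of "x ?j - y k" "y ?j - y k"] by (simp add: a_def)
    then have "(1 - t k) * norm (x ?j - y ?j) \<le> (1 - t k) * a k + (1 - t k) * \<delta>"
      using t(2)[of k] by (simp add: mult_left_mono flip: distrib_left)
    \<comment> \<open>Nonnegativity of \<open>\<delta>\<close> needs \<open>0 \<le> M\<close>, which
      the point \<open>x 0\<close> of \<open>X\<close> provides.\<close>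
    also have "(1 - t k) * \<delta> \<le> \<delta>"
      using t(1)[of k] order.trans[OF norm_ge_zero M[OF x0(1)]] pos
      by (intro mult_left_le_one_le) (auto simp: \<delta>_def t(2))
    finally have "a ?j \<le> (1 - t k) * a k + (\<delta> + \<gamma>\<^sub>f ?j * (C * q\<^sub>g ^ ?j))"
      using step[of ?j] by (simp add: a_def t_def)
    also have "\<delta> + \<gamma>\<^sub>f ?j * (C * q\<^sub>g ^ ?j) = t k * c k"
      using pos by (simp add: \<delta>_def t_def c_def field_simps power2_eq_square)
    finally show ?thesis by simp
  qed
  have c_lim: "c \<longlonglongrightarrow> 0"
  proof -
    have "(\<lambda>k. \<bar>\<epsilon> k - \<epsilon> (Suc k)\<bar> / (\<gamma>\<^sub>f (Suc k) * (\<epsilon> (Suc k))\<^sup>2)) \<longlonglongrightarrow> 0"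
      using LIMSEQ_Suc[OF assms(22)] by simp
    moreover have "(\<lambda>k. q\<^sub>g ^ Suc k / \<epsilon> (Suc k)) \<longlonglongrightarrow> 0"
      using LIMSEQ_Suc[OF assms(26)] by simp
    ultimately show ?thesis
      unfolding c_def by (intro tendsto_add_zero tendsto_mult_right_zero)
  qed
  \<comment> \<open>The given series starts at 1, which is exactly the index carried by
    \<open>t 0\<close>.\<close>
  have "(\<Sum>k=1..N. \<gamma>\<^sub>f k * \<epsilon> k) / 2 = (\<Sum>k<N. t k)" for N
    by (simp add: t_def sum_divide_distrib sum.shift_bounds_cl_Suc_ivl
        flip: sum.atLeast1_atMost_eq[of "\<lambda>k. \<gamma>\<^sub>f k * \<epsilon> k / 2"])
  then have div: "filterlim (\<lambda>N. \<Sum>k<N. t k) at_top sequentially"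
    using filterlim_at_top_mult_tendsto_pos[OF tendsto_const[of "1/2"] _ assms(21)] by simp
  have "a \<longlonglongrightarrow> 0"
    by (rule averaged_recursion_tendsto_0[OF _ t rec c_lim div]) (simp add: a_def)
  then have "(\<lambda>k. (x (Suc k) - y k) + y k) \<longlonglongrightarrow> 0 + x\<^sub>s"
    unfolding a_def by (intro tendsto_add y_lim) (rule tendsto_norm_zero_cancel)
  then have "x \<longlonglongrightarrow> x\<^sub>s" by (simp add: filterlim_sequentially_Suc)
  with \<theta>\<^sub>s x\<^sub>s show ?thesis by blast
qed

end
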